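(* For all $K<0$, $N\in(1,\infty)$ and $D\in(0,\infty)$: $$\lambda[h_{K,N,D}]\ \ge\ \frac14\max\Big(|K|(N-1),\frac{N^2}{D^2}\Big)\,\sigma^{(1/2)}_{K,N-1}(D)^{N-1}.$$
   Context: For $K<0$ put $s(\theta):=s_{K/(N-1)}(\theta)=\sqrt{\tfrac{N-1}{-K}}\,\sinh\!\big(\sqrt{\tfrac{-K}{N-1}}\,\theta\big)$, $\theta\ge0$. Then $\sigma^{(1/2)}_{K,N-1}(D):=\frac{s(D/2)}{s(D)}=\frac{\sinh(\sqrt{-K/(N-1)}\,D/2)}{\sinh(\sqrt{-K/(N-1)}\,D)}$. The density $h_{K,N,D}:\mathbb R\to[0,\infty)$ is $h_{K,N,D}(x)=s(D-x)^{N-1}$ for $x\in[0,D/2]$, $h_{K,N,D}(x)=s(x)^{N-1}$ for $x\in[D/2,D]$, and $0$ outside $[0,D]$. For a non-negative density $h$ on $\mathbb R$, $$\lambda[h]:=\inf\Big\{\frac{\int_{\mathbb R}|f'|^2h\,dx}{\int_{\mathbb R} f^2h\,dx}: f:\mathbb R\to\mathbb R\text{ locally Lipschitz},\ \int fh\,dx=0,\ 0<\int f^2h\,dx<\infty\Big\}.$$ *)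

theory Defs
  imports "HOL-Analysis.Analysis"
begin

(* Only the case \<kappa> < 0 is meant; for \<kappa> = K / (N - 1) the prefactor is sqrt ((N - 1) / (- K)). *)
definition s_fun :: "real \<Rightarrow> real \<Rightarrow> real" where
  "s_fun \<kappa> \<theta> = sqrt (1 / (- \<kappa>)) * sinh (sqrt (- \<kappa>) * \<theta>)"

definition sigma_half :: "real \<Rightarrow> real \<Rightarrow> real \<Rightarrow> real" where
  "sigma_half K M D = s_fun (K / M) (D / 2) / s_fun (K / M) D"

(* The two branches agree at x = D / 2. *)
definition h_dens :: "real \<Rightarrow> real \<Rightarrow> real \<Rightarrow> real \<Rightarrow> real" where
  "h_dens K N D x =
     (if x \<in> {0..D / 2} then s_fun (K / (N - 1)) (D - x) powr (N - 1)
      else if x \<in> {D / 2..D} then s_fun (K / (N - 1)) x powr (N - 1)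
      else 0)"

definition locally_lipschitz :: "(real \<Rightarrow> real) \<Rightarrow> bool" where
  "locally_lipschitz f \<longleftrightarrow> (\<forall>x. \<exists>u>0. \<exists>L. L-lipschitz_on (ball x u) f)"

(* Test functions in the variational problem. The condition that f h has integral 0 includes
   its integrability, since the Bochner integral of a non-integrable function is 0 by convention. *)
definition admissible :: "(real \<Rightarrow> real) \<Rightarrow> (real \<Rightarrow> real) \<Rightarrow> bool" where
  "admissible h f \<longleftrightarrow>
     locally_lipschitz f \<and>
     has_bochner_integral lborel (\<lambda>x. f x * h x) 0 \<and>
     0 < (\<integral>\<^sup>+x. ennreal ((f x)\<^sup>2 * h x) \<partial>lborel) \<and>
     (\<integral>\<^sup>+x. ennreal ((f x)\<^sup>2 * h x) \<partial>lborel) < \<infinity>"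

(* The spectral gap of a density h \<ge> 0, with values in [0, \<infinity>]: the Dirichlet energy of an
   admissible f may be infinite for general h, and the infimum of the empty set is \<infinity>.
   A locally Lipschitz f is differentiable almost everywhere, so the values of deriv f
   at the remaining points do not matter. *)
definition spectral_gap :: "(real \<Rightarrow> real) \<Rightarrow> ennreal" where
  "spectral_gap h =
     (INF f\<in>{f. admissible h f}.
        (\<integral>\<^sup>+x. ennreal (\<bar>deriv f x\<bar>\<^sup>2 * h x) \<partial>lborel) / (\<integral>\<^sup>+x. ennreal ((f x)\<^sup>2 * h x) \<partial>lborel))"

end

theory Submission
  imports Defs
begin

text \<open>
  On each half of $[0,D]$ the Cauchy--Schwarz inequality gives
  $(f(x)-f(D/2))^2 \le V \int f'^2 h$, hence $\int f^2 h \le \int (f-f(D/2))^2 h \le H V \int f'^2 h$,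
  where $H$ and $V$ are the integrals of $h$ and $1/h$ over $[D/2,D]$.
  On that interval $h' \ge \kappa h$ for both $\kappa = \sqrt{-K(N-1)}$ and $\kappa = (N-1)/D$, so
  $H \le h(D)\tau$ and $V \le \tau/h(D/2)$ with $\tau = 1/\kappa$, while $\tau = D/2$ works trivially;
  for $\tau = 1/\kappa$ with the second $\kappa$ this suffices when $N \ge 2$, and $\tau = D/2$ covers $N \le 2$.

  The fundamental theorem of calculus for a Lipschitz $F$ rests on the strictly
  increasing bi-Lipschitz map $G(x) = F(x) + (L+1)x$: the image of Lebesgue measure under
  $G^{-1}$ has a Radon--Nikodym density $w$, and a Vitali covering argument identifies $w$ with $G'$
  almost everywhere.
\<close>

section \<open>Almost everywhere differentiability of Lipschitz functions\<close>

text \<open>Inside any open set around \<open>A\<close>, the Vitali covering theorem selects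
  countably many disjoint balls from the cover that exhaust \<open>A\<close> up to a null set.
  Summing the ball inequalities bounds the integral of \<open>v\<close> over \<open>A\<close> by
  that of \<open>w\<close> over the open set, and outer regularity shrinks the open set to
  \<open>A\<close>. The balls need only contain \<open>x\<close>, not be centred there, so one-sided
  intervals are allowed.\<close>

lemma nn_integral_le_of_Vitali_cover:
  fixes v w :: "real \<Rightarrow> ennreal"
  assumes [measurable]: "v \<in> borel_measurable borel" "w \<in> borel_measurable borel" "A \<in> sets borel"
    and A: "A \<subseteq> {a<..<b}" and fin: "(\<integral>\<^sup>+x\<in>{a<..<b}. w x \<partial>lborel) < \<infinity>"
    and cover: "\<And>x d. x \<in> A \<Longrightarrow> 0 < d \<Longrightarrow> \<exists>y r. 0 < r \<and> r < d \<and> x \<in> cball y r \<and>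
      (\<integral>\<^sup>+t\<in>cball y r. v t \<partial>lborel) \<le> (\<integral>\<^sup>+t\<in>cball y r. w t \<partial>lborel)"
  shows "(\<integral>\<^sup>+x\<in>A. v x \<partial>lborel) \<le> (\<integral>\<^sup>+x\<in>A. w x \<partial>lborel)"
proof -
  \<comment> \<open>Cutting \<open>w\<close> off outside the bounded interval makes the measure
    finite, which outer regularity asks for.\<close>
  define N where "N = density lborel (\<lambda>x. w x * indicator {a<..<b} x)"
  have NA: "emeasure N S = (\<integral>\<^sup>+x\<in>S \<inter> {a<..<b}. w x \<partial>lborel)" if [measurable]: "S \<in> sets borel" for S
    unfolding N_def by (subst emeasure_density) (auto intro!: nn_integral_cong simp: indicator_def)
  have "emeasure N A = (INF U\<in>{U. A \<subseteq> U \<and> open U}. emeasure N U)"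
  proof (rule outer_regular)
    show "emeasure N (space N) \<noteq> \<infinity>"
      using fin NA[of UNIV] by (simp add: N_def less_top)
  qed (auto simp: N_def)
  also have "\<dots> \<ge> (\<integral>\<^sup>+x\<in>A. v x \<partial>lborel)"
  proof (rule INF_greatest, clarify)
    fix U assume U: "A \<subseteq> U" "open U"
    define V where "V = U \<inter> {a<..<b}"
    have V: "open V" "A \<subseteq> V" using U A by (auto simp: V_def)
    define K where "K = {(y, r). 0 < r \<and> cball y r \<subseteq> V \<and>
      (\<integral>\<^sup>+t\<in>cball y r. v t \<partial>lborel) \<le> (\<integral>\<^sup>+t\<in>cball y r. w t \<partial>lborel)}"
    have "\<exists>i. i \<in> K \<and> x \<in> cball (fst i) (snd i) \<and> snd i < d" if x: "x \<in> A" and d: "0 < d" for x d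
    proof -
      obtain e where e: "e > 0" "ball x e \<subseteq> V" using V x openE by blast
      \<comment> \<open>The point \<open>x\<close> may lie on the boundary of the ball, so radius
        below \<open>e/2\<close> is what keeps the whole ball inside
        \<open>ball x e\<close>.\<close>
      obtain y r where yr: "0 < r" "r < min d (e/2)" "x \<in> cball y r"
        "(\<integral>\<^sup>+t\<in>cball y r. v t \<partial>lborel) \<le> (\<integral>\<^sup>+t\<in>cball y r. w t \<partial>lborel)"
        using cover[OF x, of "min d (e/2)"] d e by auto
      have "cball y r \<subseteq> ball x e"
      proof
        fix t assume "t \<in> cball y r"
        then show "t \<in> ball x e" using yr dist_triangle[of x t y] by (auto simp: dist_commute)
      qed
      then show ?thesis using yr e by (intro exI[of _ "(y,r)"]) (auto simp: K_def)
    qed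
    moreover have "0 < snd i" if "i \<in> K" for i using that by (auto simp: K_def)
    ultimately obtain C where C: "countable C" "C \<subseteq> K"
       "pairwise (\<lambda>i j. disjnt (cball (fst i) (snd i)) (cball (fst j) (snd j))) C"
       "negligible (A - (\<Union>i \<in> C. cball (fst i) (snd i)))"
      using Vitali_covering_theorem_cballs[of K snd A fst] by blast
    define W where "W = (\<Union>i \<in> C. cball (fst i) (snd i))"
    have W[measurable]: "W \<in> sets borel" unfolding W_def by (intro sets.countable_UN' C) auto
    have dj: "disjoint_family_on (\<lambda>i. cball (fst i) (snd i)) C"
      using C(3) by (auto simp: disjoint_family_on_def pairwise_def disjnt_def)
    have sum: "(\<integral>\<^sup>+x\<in>W. g x \<partial>lborel) = (\<integral>\<^sup>+i. (\<integral>\<^sup>+x\<in>cball (fst i) (snd i). g x \<partial>lborel) \<partial>count_space C)"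
      if [measurable]: "g \<in> borel_measurable borel" for g :: "real \<Rightarrow> ennreal"
    proof -
      have "(\<integral>\<^sup>+x\<in>W. g x \<partial>lborel) = emeasure (density lborel g) W" by (simp add: emeasure_density)
      also have "\<dots> = (\<integral>\<^sup>+i. emeasure (density lborel g) (cball (fst i) (snd i)) \<partial>count_space C)"
        unfolding W_def by (rule emeasure_UN_countable[OF _ C(1) dj]) auto
      finally show ?thesis by (simp add: emeasure_density)
    qed
    \<comment> \<open>Negligibility refers to the completed measure; since \<open>A - W\<close> is
      Borel, it is null for \<open>lborel\<close> too, and \<open>A\<close> may be replaced by
      \<open>W\<close> in the integral of \<open>v\<close>.\<close>
    have "A - W \<in> null_sets lborel"
    proof -
      have "A - W \<in> null_sets lebesgue" using C(4) by (simp add: W_def negligible_iff_null_sets)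
      then show ?thesis by (simp add: null_sets_completion_iff)
    qed
    then have "AE x in lborel. x \<notin> A - W" by (rule AE_not_in)
    then have "(\<integral>\<^sup>+x\<in>A. v x \<partial>lborel) \<le> (\<integral>\<^sup>+x\<in>W. v x \<partial>lborel)"
      by (intro nn_integral_mono_AE) (auto simp: indicator_def)
    also have "\<dots> \<le> (\<integral>\<^sup>+x\<in>W. w x \<partial>lborel)"
      unfolding sum[OF assms(1)] sum[OF assms(2)] 
    proof (rule nn_integral_mono)
      fix i assume "i \<in> space (count_space C)"
      then have "i \<in> K" using C(2) by auto
      then show "(\<integral>\<^sup>+x\<in>cball (fst i) (snd i). v x \<partial>lborel) \<le> (\<integral>\<^sup>+x\<in>cball (fst i) (snd i). w x \<partial>lborel)"
        by (auto simp: K_def)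
    qed
    also have "\<dots> \<le> emeasure N U"

    proof -
      have "W \<subseteq> U \<inter> {a<..<b}" using C(2) by (force simp: W_def K_def V_def)
      then show ?thesis using U
        by (subst NA) (auto intro!: nn_integral_mono mult_left_mono indicator_leI simp del: indicator_inter_arith)
    qed
    finally show "(\<integral>\<^sup>+x\<in>A. v x \<partial>lborel) \<le> emeasure N U" .
  qed
  also have "emeasure N A = (\<integral>\<^sup>+x\<in>A. w x \<partial>lborel)"
    using A by (subst NA) (auto intro!: nn_integral_cong simp: indicator_def)
  finally show ?thesis .
qed

text \<open>Suppose that on a bounded set \<open>A\<close> the density is at most \<open>p\<close>,
  while each point of \<open>A\<close> sees slopes of \<open>G\<close> above \<open>q > p\<close> at
  arbitrarily small scales. The covering lemma gives \<open>q |A| \<le> p |A|\<close>, so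
  \<open>A\<close> is null; slopes that are too small are excluded in the same way. Running through
  countably many rational \<open>p\<close>, \<open>q\<close> and bounded windows squeezes the
  difference quotients to \<open>w x\<close> almost everywhere.\<close>

lemma AE_has_real_derivative_density:
  fixes G :: "real \<Rightarrow> real" and w :: "real \<Rightarrow> ennreal"
  assumes [measurable]: "w \<in> borel_measurable borel"
    and cont: "continuous_on UNIV G" and mono: "mono G"
    and int: "\<And>a b. a \<le> b \<Longrightarrow> (\<integral>\<^sup>+x\<in>{a..b}. w x \<partial>lborel) = ennreal (G b - G a)"
  shows "AE x in lborel. w x \<noteq> \<infinity> \<and> (G has_real_derivative enn2real (w x)) (at x)"
proof -
  have Gc: "isCont G x" for x using cont by (simp add: continuous_on_eq_continuous_at)
  have fin: "(\<integral>\<^sup>+x\<in>{a<..<b}. w x \<partial>lborel) < \<infinity>" if "a \<le> b" for a b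
  proof -
    have "(\<integral>\<^sup>+x\<in>{a<..<b}. w x \<partial>lborel) \<le> (\<integral>\<^sup>+x\<in>{a..b}. w x \<partial>lborel)"
      by (intro nn_integral_mono) (auto simp: indicator_def)
    also have "\<dots> < \<infinity>" by (simp add: int[OF that])
    finally show ?thesis .
  qed
  \<comment> \<open>The closed interval between \<open>x\<close> and \<open>y\<close> is a ball of
    radius \<open>\<bar>y - x\<bar> / 2\<close> around the midpoint, and its \<open>w\<close>-mass
    is the increment of \<open>G\<close>.\<close>
  have slope_ball: "\<exists>c r. 0 < r \<and> r < \<bar>y - x\<bar> \<and> x \<in> cball c r \<and>
      (\<integral>\<^sup>+t\<in>cball c r. w t \<partial>lborel) = ennreal \<bar>G y - G x\<bar> \<and>
      (\<forall>q\<ge>0. (\<integral>\<^sup>+t\<in>cball c r. ennreal q \<partial>lborel) = ennreal (q * \<bar>y - x\<bar>))"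
    if "0 < \<bar>y - x\<bar>" for x y
  proof -
    have *: "cball ((x+y)/2) (\<bar>y - x\<bar>/2) = {min x y..max x y}"
      unfolding cball_eq_atLeastAtMost by (auto simp: min_def max_def abs_if field_simps)
    have "(\<integral>\<^sup>+t\<in>{min x y..max x y}. w t \<partial>lborel) = ennreal \<bar>G y - G x\<bar>"
      by (subst int) (use monoD[OF mono, of x y] monoD[OF mono, of y x] in \<open>auto simp: min_def max_def abs_if\<close>)
    moreover have "(\<integral>\<^sup>+t\<in>{min x y..max x y}. ennreal q \<partial>lborel) = ennreal (q * \<bar>y - x\<bar>)" if "q \<ge> 0" for q
      using that by (subst nn_integral_cmult_indicator) (auto simp: ennreal_mult min_def max_def abs_if)
    ultimately show ?thesis using that
      by (intro exI[of _ "(x+y)/2"] exI[of _ "\<bar>y - x\<bar>/2"]) (auto simp: * )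
  qed
  \<comment> \<open>The window from \<open>-k\<close> to \<open>k\<close> makes the measure of
    \<open>A\<close> finite, so that it can be cancelled.\<close>
  have null: "A \<in> null_sets lborel"
    if [measurable]: "A \<in> sets borel" and A: "A \<subseteq> {-k<..<k}" and "0 \<le> p" "p < q"
      and le: "ennreal q * emeasure lborel A \<le> ennreal p * emeasure lborel A" for A and k p q :: real
  proof -
    have "emeasure lborel A \<le> emeasure lborel {-k..k}"
      using A by (intro emeasure_mono) auto
    also have "\<dots> < \<infinity>" by (cases "k \<ge> 0") auto
    finally obtain m where m: "emeasure lborel A = ennreal m" "m \<ge> 0"
      by (cases "emeasure lborel A") auto
    with le that(3,4) have "q * m \<le> p * m"
      by (simp add: ennreal_mult[symmetric])
    with m that(4) have "m = 0" by (smt (verit) mult_less_cancel_right)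
    with m show ?thesis by (auto simp: null_sets_def)
  qed
  have up: "AE x in lborel. x \<in> {-k<..<k} \<and> w x \<le> ennreal p \<longrightarrow>
     (\<exists>n::nat. \<forall>y. 0 < \<bar>y - x\<bar> \<and> \<bar>y - x\<bar> < 1 / Suc n \<longrightarrow> \<bar>G y - G x\<bar> \<le> q * \<bar>y - x\<bar>)"
    if pq: "0 \<le> p" "p < q" for k p q :: real
  proof -
    \<comment> \<open>Each set in the union is open by continuity of \<open>G\<close>; hence
      \<open>U n\<close> is open and thus Borel, although \<open>y\<close> ranges over an
      uncountable set.\<close>
    define U where "U n = (\<Union>y. {x. 0 < \<bar>y - x\<bar> \<and> \<bar>y - x\<bar> < 1 / Suc n \<and> q * \<bar>y - x\<bar> < \<bar>G y - G x\<bar>})" for n :: nat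
    have [measurable]: "U n \<in> sets borel" for n
      unfolding U_def by (intro borel_open open_UN ballI open_Collect_conj open_Collect_less continuous_intros cont)
    define A where "A = {x\<in>{-k<..<k}. w x \<le> ennreal p \<and> (\<forall>n. x \<in> U n)}"
    have A_meas[measurable]: "A \<in> sets borel" unfolding A_def by measurable
    have "ennreal q * emeasure lborel A = (\<integral>\<^sup>+x\<in>A. ennreal q \<partial>lborel)"
      by (simp add: nn_integral_cmult_indicator)
    also have "\<dots> \<le> (\<integral>\<^sup>+x\<in>A. w x \<partial>lborel)"
    proof (cases "0 \<le> k")
      case True
      show ?thesis
      proof (rule nn_integral_le_of_Vitali_cover)
        show "A \<subseteq> {-k<..<k}" by (auto simp: A_def)
        show "(\<integral>\<^sup>+x\<in>{-k<..<k}. w x \<partial>lborel) < \<infinity>" using True by (intro fin) auto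
        fix x d :: real assume x: "x \<in> A" and d: "0 < d"
        obtain n :: nat where n: "1 / Suc n < d" using d by (metis nat_approx_posE of_nat_Suc)
        obtain y where y: "0 < \<bar>y - x\<bar>" "\<bar>y - x\<bar> < 1 / Suc n" "q * \<bar>y - x\<bar> < \<bar>G y - G x\<bar>"
          using x unfolding A_def U_def by blast
        show "\<exists>c r. 0 < r \<and> r < d \<and> x \<in> cball c r \<and>
            (\<integral>\<^sup>+t\<in>cball c r. ennreal q \<partial>lborel) \<le> (\<integral>\<^sup>+t\<in>cball c r. w t \<partial>lborel)"
        proof -
          obtain c r where cr: "0 < r" "r < \<bar>y - x\<bar>" "x \<in> cball c r"
            "(\<integral>\<^sup>+t\<in>cball c r. w t \<partial>lborel) = ennreal \<bar>G y - G x\<bar>"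
            "(\<integral>\<^sup>+t\<in>cball c r. ennreal q \<partial>lborel) = ennreal (q * \<bar>y - x\<bar>)"
            using slope_ball[OF y(1)] pq by force
          have "r < d" using cr(2) y(2) n by linarith
          with cr y(3) show ?thesis
            by (intro exI[of _ c] exI[of _ r]) (simp add: ennreal_leI)
        qed
      qed auto
    qed (auto simp: A_def)
    also have "\<dots> \<le> (\<integral>\<^sup>+x\<in>A. ennreal p \<partial>lborel)"
      by (intro nn_integral_mono) (auto simp: A_def indicator_def)
    also have "\<dots> = ennreal p * emeasure lborel A"
      by (simp add: nn_integral_cmult_indicator)
    finally have "A \<in> null_sets lborel"
      using pq by (intro null[of A k p q]) (auto simp: A_def)
    then have "AE x in lborel. x \<notin> A" by (rule AE_not_in)
    then show ?thesis
    proof eventually_elim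
      case (elim x)
      show ?case
      proof (rule impI)
        assume "x \<in> {-k<..<k} \<and> w x \<le> ennreal p"
        with elim obtain n where "x \<notin> U n" by (auto simp: A_def)
        then show "\<exists>n::nat. \<forall>y. 0 < \<bar>y - x\<bar> \<and> \<bar>y - x\<bar> < 1 / Suc n \<longrightarrow> \<bar>G y - G x\<bar> \<le> q * \<bar>y - x\<bar>"
          by (intro exI[of _ n]) (auto simp: U_def not_less)
      qed
    qed
  qed
  \<comment> \<open>The mirror image of \<open>up\<close>: in the covering lemma the density now
    stands on the smaller side and the constant \<open>q\<close> on the larger one.\<close>
  have low: "AE x in lborel. x \<in> {-k<..<k} \<and> ennreal p \<le> w x \<longrightarrow>
     (\<exists>n::nat. \<forall>y. 0 < \<bar>y - x\<bar> \<and> \<bar>y - x\<bar> < 1 / Suc n \<longrightarrow> q * \<bar>y - x\<bar> \<le> \<bar>G y - G x\<bar>)"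
    if pq: "0 \<le> q" "q < p" for k p q :: real
  proof -
    define U where "U n = (\<Union>y. {x. 0 < \<bar>y - x\<bar> \<and> \<bar>y - x\<bar> < 1 / Suc n \<and> \<bar>G y - G x\<bar> < q * \<bar>y - x\<bar>})" for n :: nat
    have [measurable]: "U n \<in> sets borel" for n
      unfolding U_def by (intro borel_open open_UN ballI open_Collect_conj open_Collect_less continuous_intros cont)
    define A where "A = {x\<in>{-k<..<k}. ennreal p \<le> w x \<and> (\<forall>n. x \<in> U n)}"
    have A_meas[measurable]: "A \<in> sets borel" unfolding A_def by measurable
    have "ennreal p * emeasure lborel A = (\<integral>\<^sup>+x\<in>A. ennreal p \<partial>lborel)"
      by (simp add: nn_integral_cmult_indicator)
    also have "\<dots> \<le> (\<integral>\<^sup>+x\<in>A. w x \<partial>lborel)"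
      by (intro nn_integral_mono) (auto simp: A_def indicator_def)
    also have "\<dots> \<le> (\<integral>\<^sup>+x\<in>A. ennreal q \<partial>lborel)"
    proof (cases "0 \<le> k")
      case True
      show ?thesis
      proof (rule nn_integral_le_of_Vitali_cover)
        show "A \<subseteq> {-k<..<k}" by (auto simp: A_def)
        show "(\<integral>\<^sup>+x\<in>{-k<..<k}. ennreal q \<partial>lborel) < \<infinity>" using True
          by (subst nn_integral_cmult_indicator) (auto simp: ennreal_mult_less_top)
        fix x d :: real assume x: "x \<in> A" and d: "0 < d"
        obtain n :: nat where n: "1 / Suc n < d" using d by (metis nat_approx_posE of_nat_Suc)
        obtain y where y: "0 < \<bar>y - x\<bar>" "\<bar>y - x\<bar> < 1 / Suc n" "\<bar>G y - G x\<bar> < q * \<bar>y - x\<bar>"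
          using x unfolding A_def U_def by blast
        show "\<exists>c r. 0 < r \<and> r < d \<and> x \<in> cball c r \<and>
            (\<integral>\<^sup>+t\<in>cball c r. w t \<partial>lborel) \<le> (\<integral>\<^sup>+t\<in>cball c r. ennreal q \<partial>lborel)"
        proof -
          obtain c r where cr: "0 < r" "r < \<bar>y - x\<bar>" "x \<in> cball c r"
            "(\<integral>\<^sup>+t\<in>cball c r. w t \<partial>lborel) = ennreal \<bar>G y - G x\<bar>"
            "(\<integral>\<^sup>+t\<in>cball c r. ennreal q \<partial>lborel) = ennreal (q * \<bar>y - x\<bar>)"
            using slope_ball[OF y(1)] pq by force
          have "r < d" using cr(2) y(2) n by linarith
          with cr y(3) show ?thesis
            by (intro exI[of _ c] exI[of _ r]) (simp add: ennreal_leI)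
        qed
      qed auto
    qed (auto simp: A_def)
    also have "\<dots> = ennreal q * emeasure lborel A"
      by (simp add: nn_integral_cmult_indicator)
    finally have "A \<in> null_sets lborel"
      using pq by (intro null[of A k q p]) (auto simp: A_def)
    then have "AE x in lborel. x \<notin> A" by (rule AE_not_in)
    then show ?thesis
    proof eventually_elim
      case (elim x)
      show ?case
      proof (rule impI)
        assume "x \<in> {-k<..<k} \<and> ennreal p \<le> w x"
        with elim obtain n where "x \<notin> U n" by (auto simp: A_def)
        then show "\<exists>n::nat. \<forall>y. 0 < \<bar>y - x\<bar> \<and> \<bar>y - x\<bar> < 1 / Suc n \<longrightarrow> q * \<bar>y - x\<bar> \<le> \<bar>G y - G x\<bar>"
          by (intro exI[of _ n]) (auto simp: U_def not_less)
      qed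
    qed
  qed
  have finAE: "AE x in lborel. x \<in> {-k<..<k} \<longrightarrow> w x \<noteq> \<infinity>" for k :: real
  proof (cases "k \<ge> 0")
    case True
    have "AE x in lborel. w x * indicator {-k<..<k} x \<noteq> \<infinity>"
      by (rule nn_integral_PInf_AE) (use fin[of "-k" k] True in \<open>auto simp: less_top\<close>)
    then show ?thesis by eventually_elim (auto simp: indicator_def)
  qed auto
  \<comment> \<open>With \<open>k\<close> natural and \<open>p\<close>, \<open>q\<close> rational,
    only countably many exceptional null sets have to be discarded.\<close>
  have cN: "countable (\<nat> :: real set)" by (simp add: Nats_def)
  have "AE x in lborel. \<forall>k\<in>\<nat>. x \<in> {-k<..<k} \<longrightarrow> w x \<noteq> \<infinity>"
    unfolding AE_ball_countable[OF cN] using finAE by blast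
  moreover have "AE x in lborel. \<forall>k\<in>\<nat>. \<forall>p\<in>\<rat>. \<forall>q\<in>\<rat>. 0 \<le> p \<and> p < q \<longrightarrow> x \<in> {-k<..<k} \<and> w x \<le> ennreal p \<longrightarrow>
     (\<exists>n::nat. \<forall>y. 0 < \<bar>y - x\<bar> \<and> \<bar>y - x\<bar> < 1 / Suc n \<longrightarrow> \<bar>G y - G x\<bar> \<le> q * \<bar>y - x\<bar>)"
    unfolding AE_ball_countable[OF cN] AE_ball_countable[OF countable_rat]
    by (intro ballI AE_impI up) auto
  moreover have "AE x in lborel. \<forall>k\<in>\<nat>. \<forall>p\<in>\<rat>. \<forall>q\<in>\<rat>. 0 \<le> q \<and> q < p \<longrightarrow> x \<in> {-k<..<k} \<and> ennreal p \<le> w x \<longrightarrow>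
     (\<exists>n::nat. \<forall>y. 0 < \<bar>y - x\<bar> \<and> \<bar>y - x\<bar> < 1 / Suc n \<longrightarrow> q * \<bar>y - x\<bar> \<le> \<bar>G y - G x\<bar>)"
    unfolding AE_ball_countable[OF cN] AE_ball_countable[OF countable_rat]
    by (intro ballI AE_impI low) auto
  ultimately show ?thesis
  proof eventually_elim
    case (elim x)
    obtain k :: real where k: "k \<in> \<nat>" "x \<in> {-k<..<k}"
    proof -
      obtain m :: nat where "\<bar>x\<bar> < real m" using reals_Archimedean2 by blast
      then show ?thesis by (intro that[of "real m"]) auto
    qed
    define W where "W = enn2real (w x)"
    have W: "w x = ennreal W" "W \<ge> 0" "w x \<noteq> \<infinity>" using elim(1) k by (auto simp: W_def less_top)
    \<comment> \<open>Monotonicity turns the difference quotient into the quotient of absolute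
      values that \<open>up\<close> and \<open>low\<close> control.\<close>
    have sl: "(G y - G x) / (y - x) = \<bar>G y - G x\<bar> / \<bar>y - x\<bar>" for y
      using monoD[OF mono, of x y] monoD[OF mono, of y x] by (cases "x \<le> y") (auto simp: abs_if field_simps)
    have "((\<lambda>y. (G y - G x) / (y - x)) \<longlongrightarrow> W) (at x)"
      unfolding sl
    proof (rule order_tendstoI)
      fix a assume a: "a < W"
      show "\<forall>\<^sub>F y in at x. a < \<bar>G y - G x\<bar> / \<bar>y - x\<bar>"
      \<comment> \<open>For \<open>a < 0\<close> the claim holds because the quotients are
        nonnegative. Otherwise \<open>a < q < p < W\<close> with rational \<open>q\<close>,
        \<open>p\<close>: \<open>low\<close> applies because \<open>p \<le> w x\<close> and
        \<open>0 \<le> q < p\<close>, and \<open>a < q\<close> makes the bound strict.\<close>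
      proof (cases "a < 0")
        case False
        obtain q where q: "q \<in> \<rat>" "a < q" "q < W" using Rats_dense_in_real a by blast
        obtain p where p: "p \<in> \<rat>" "q < p" "p < W" using Rats_dense_in_real q by blast
        obtain n :: nat where n: "\<And>y. 0 < \<bar>y - x\<bar> \<Longrightarrow> \<bar>y - x\<bar> < 1 / Suc n \<Longrightarrow> q * \<bar>y - x\<bar> \<le> \<bar>G y - G x\<bar>"
          using elim(3)[rule_format, OF k(1) p(1) q(1)] p q False k W by (auto simp: ennreal_leI)
        show ?thesis unfolding eventually_at
        proof (intro exI[of _ "1 / Suc n"] conjI ballI impI)
          fix y assume "y \<noteq> x \<and> dist y x < 1 / real (Suc n)"
          with n[of y] have "0 < \<bar>y - x\<bar>" "q * \<bar>y - x\<bar> \<le> \<bar>G y - G x\<bar>" by (auto simp: dist_real_def)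
          then have "q \<le> \<bar>G y - G x\<bar> / \<bar>y - x\<bar>" by (simp add: pos_le_divide_eq)
          with q show "a < \<bar>G y - G x\<bar> / \<bar>y - x\<bar>" by linarith
        qed auto
      qed (auto intro!: always_eventually less_le_trans[of a 0])
    next
      fix a assume a: "W < a"
      obtain q where q: "q \<in> \<rat>" "W < q" "q < a" using Rats_dense_in_real a by blast
      obtain p where p: "p \<in> \<rat>" "W < p" "p < q" using Rats_dense_in_real q by blast
      obtain n :: nat where n: "\<And>y. 0 < \<bar>y - x\<bar> \<Longrightarrow> \<bar>y - x\<bar> < 1 / Suc n \<Longrightarrow> \<bar>G y - G x\<bar> \<le> q * \<bar>y - x\<bar>"
        using elim(2)[rule_format, OF k(1) p(1) q(1)] p q k W by (auto simp: ennreal_leI)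
      show "\<forall>\<^sub>F y in at x. \<bar>G y - G x\<bar> / \<bar>y - x\<bar> < a" unfolding eventually_at
      proof (intro exI[of _ "1 / Suc n"] conjI ballI impI)
        fix y assume "y \<noteq> x \<and> dist y x < 1 / real (Suc n)"
        with n[of y] have "0 < \<bar>y - x\<bar>" "\<bar>G y - G x\<bar> \<le> q * \<bar>y - x\<bar>" by (auto simp: dist_real_def)
        then have "\<bar>G y - G x\<bar> / \<bar>y - x\<bar> \<le> q" by (simp add: pos_divide_le_eq)
        with q show "\<bar>G y - G x\<bar> / \<bar>y - x\<bar> < a" by linarith
      qed auto
    qed
    then show ?case using W(3) unfolding has_field_derivative_iff W_def by blast
  qed
qed

text \<open>The function \<open>u\<close> is a Borel representative of the derivative, and the last
  conclusion is the half of the fundamental theorem of calculus on which the Poincare estimate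
  rests.\<close>

lemma lipschitz_AE_derivative:
  fixes F :: "real \<Rightarrow> real"
  assumes F: "L-lipschitz_on UNIV F"
  obtains u where "u \<in> borel_measurable borel"
    and "AE x in lborel. (F has_real_derivative u x) (at x)"
    and "\<And>a b. a \<le> b \<Longrightarrow> ennreal \<bar>F b - F a\<bar> \<le> (\<integral>\<^sup>+x\<in>{a..b}. ennreal \<bar>u x\<bar> \<partial>lborel)"
proof -
  have L: "0 \<le> L" "\<bar>F y - F x\<bar> \<le> L * \<bar>y - x\<bar>" for x y
    using F by (auto simp: lipschitz_on_def dist_real_def)
  \<comment> \<open>The coefficient \<open>L + 1\<close> instead of \<open>L\<close> makes every
    slope of \<open>G\<close> at least 1, so that \<open>G\<close> is a bijection with 1-Lipschitz
    inverse.\<close>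
  define G where "G x = F x + (L + 1) * x" for x
  have G_ge: "y - x \<le> G y - G x" if "x \<le> y" for x y
    using L(2)[of y x] that by (auto simp: G_def abs_if algebra_simps split: if_splits)
  have G_lip: "\<bar>G y - G x\<bar> \<le> (2 * L + 1) * \<bar>y - x\<bar>" for x y
  proof -
    have "G y - G x = (F y - F x) + (L + 1) * (y - x)" by (simp add: G_def algebra_simps)
    then have "\<bar>G y - G x\<bar> \<le> \<bar>F y - F x\<bar> + (L + 1) * \<bar>y - x\<bar>"
      using L(1) abs_triangle_ineq[of "F y - F x" "(L + 1) * (y - x)"] by (simp add: abs_mult)
    with L(2)[of y x] show ?thesis by (simp add: algebra_simps)
  qed
  have mono: "mono G" 
  proof (rule monoI)
    fix x y :: real assume "x \<le> y"
    then show "G x \<le> G y" using G_ge[of x y] by auto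
  qed
  have inj: "inj G" 
  proof (rule linorder_injI)
    fix x y :: real assume "x < y"
    then show "G x \<noteq> G y" using G_ge[of x y] by auto
  qed
  have cont: "continuous_on S G" for S
    unfolding G_def
    by (intro continuous_intros continuous_on_subset[OF lipschitz_on_continuous_on[OF F]] subset_UNIV)
  have surj: "surj G"
  proof -
    have "\<exists>x. G x = z" for z
    proof -
      define t where "t = \<bar>z - G 0\<bar>"
      have "G (-t) \<le> z" "z \<le> G t" "-t \<le> t"
        using G_ge[of "-t" 0] G_ge[of 0 t] by (auto simp: t_def)
      then show ?thesis using IVT'[of G "-t" z t] cont by blast
    qed
    then show ?thesis by (metis surj_def)
  qed
  have GJ: "G (inv G z) = z" for z by (rule surj_f_inv_f[OF surj])
  have JG: "inv G (G x) = x" for x by (rule inv_f_f[OF inj])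
  have "\<bar>inv G y - inv G x\<bar> \<le> 1 * \<bar>y - x\<bar>" for x y
    using G_ge[of "inv G x" "inv G y"] G_ge[of "inv G y" "inv G x"] by (auto simp: GJ abs_if)
  then have "1-lipschitz_on UNIV (inv G)"
    by (intro lipschitz_onI) (auto simp: dist_real_def)
  then have [measurable]: "inv G \<in> borel_measurable borel"
    by (intro borel_measurable_continuous_onI lipschitz_on_continuous_on)
  define N where "N = distr lborel borel (inv G)"
  have N: "emeasure N A = emeasure lborel (inv G -` A)" if "A \<in> sets borel" for A
    using that by (simp add: N_def emeasure_distr)
  have "absolutely_continuous lborel N"
    unfolding absolutely_continuous_def
  proof
    fix A :: "real set" assume A: "A \<in> null_sets lborel"
    have "inv G -` A = G ` A" by (force simp: GJ JG image_iff)
    moreover have "negligible A"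
      using A by (auto simp: negligible_iff_null_sets null_sets_completionI)
    then have "negligible (G ` A)"
      using G_lip
      by (intro negligible_locally_Lipschitz_image exI[of _ UNIV] exI[of _ "2 * L + 1"]) auto
    moreover have "inv G -` A \<in> sets lborel"
      using measurable_sets_borel[OF \<open>inv G \<in> borel_measurable borel\<close>, of A] A by (simp add: null_sets_def)
    ultimately have "inv G -` A \<in> null_sets lborel"
      by (simp add: negligible_iff_null_sets null_sets_completion_iff)
    then show "A \<in> null_sets N" using A by (auto simp: null_sets_def N) (auto simp: N_def)
  qed
  then obtain w where w[measurable]: "w \<in> borel_measurable borel" and wN: "density lborel w = N"
    using sigma_finite_measure.Radon_Nikodym[of lborel N] by (auto simp: N_def sigma_finite_lborel)
  have int: "(\<integral>\<^sup>+x\<in>{a..b}. w x \<partial>lborel) = ennreal (G b - G a)" if "a \<le> b" for a b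
  proof -
    have "inv G -` {a..b} = {G a..G b}"

    proof -
      have le: "G s \<le> G t \<longleftrightarrow> s \<le> t" for s t
        using G_ge[of s t] G_ge[of t s] by linarith
      show ?thesis
        using le[of a "inv G z" for z] le[of "inv G z" b for z] by (intro set_eqI) (simp add: GJ)
    qed
    then show ?thesis
      using N[of "{a..b}"] emeasure_density[of w lborel "{a..b}"] monoD[OF mono that] by (simp add: wN)
  qed
  have AE: "AE x in lborel. w x \<noteq> \<infinity> \<and> (G has_real_derivative enn2real (w x)) (at x)"
    by (rule AE_has_real_derivative_density) (use cont mono int in auto)
  \<comment> \<open>Subtracting \<open>L + 1\<close> undoes the linear term that was added to
    \<open>F\<close>. The value of \<open>enn2real\<close> at points where \<open>w\<close> is
    infinite is immaterial, since these form a null set.\<close>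
  define u where "u x = enn2real (w x) - (L + 1)" for x
  show thesis
  proof
    show [measurable]: "u \<in> borel_measurable borel" unfolding u_def by measurable
    show "AE x in lborel. (F has_real_derivative u x) (at x)"
      using AE
    proof eventually_elim
      case (elim x)
      then have "((\<lambda>x. G x - (L + 1) * x) has_real_derivative enn2real (w x) - (L + 1)) (at x)"
        by (auto intro!: derivative_eq_intros)
      then show ?case by (simp add: G_def u_def)
    qed
    fix a b :: real assume ab: "a \<le> b"
    have "(\<integral>\<^sup>+x. ennreal (enn2real (w x) * indicator {a..b} x) \<partial>lborel) = (\<integral>\<^sup>+x\<in>{a..b}. w x \<partial>lborel)"
      by (rule nn_integral_cong_AE, use AE in eventually_elim) (auto simp: indicator_def less_top)
    then have "has_bochner_integral lborel (\<lambda>x. enn2real (w x) * indicator {a..b} x) (G b - G a)"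
      using monoD[OF mono ab] by (intro has_bochner_integral_nn_integral) (auto simp: int[OF ab])
    moreover have "has_bochner_integral lborel (\<lambda>x. indicator {a..b} x *\<^sub>R (L + 1)) (measure lborel {a..b} *\<^sub>R (L + 1))"
      by (rule has_bochner_integral_indicator) (use ab in auto)
    ultimately have *: "has_bochner_integral lborel
        (\<lambda>x. enn2real (w x) * indicator {a..b} x - indicator {a..b} x *\<^sub>R (L + 1)) (G b - G a - measure lborel {a..b} *\<^sub>R (L + 1))"
      by (rule has_bochner_integral_diff)
    have "(\<lambda>x. enn2real (w x) * indicator {a..b} x - indicator {a..b} x *\<^sub>R (L + 1)) = (\<lambda>x. u x * indicator {a..b} x)"
      by (rule ext) (simp add: u_def indicator_def)
    moreover have "G b - G a - measure lborel {a..b} *\<^sub>R (L + 1) = F b - F a"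
      using ab by (simp add: G_def algebra_simps)
    ultimately have "has_bochner_integral lborel (\<lambda>x. u x * indicator {a..b} x) (F b - F a)"
      using * by simp
    then have "ennreal \<bar>F b - F a\<bar> \<le> (\<integral>\<^sup>+x. ennreal (norm (u x * indicator {a..b} x)) \<partial>lborel)"
      using integral_norm_bound_ennreal[of lborel "\<lambda>x. u x * indicator {a..b} x"]
      by (simp only: has_bochner_integral_iff real_norm_def)
    also have "\<dots> = (\<integral>\<^sup>+x\<in>{a..b}. ennreal \<bar>u x\<bar> \<partial>lborel)"
      by (intro nn_integral_cong) (simp add: indicator_def)
    finally show "ennreal \<bar>F b - F a\<bar> \<le> (\<integral>\<^sup>+x\<in>{a..b}. ennreal \<bar>u x\<bar> \<partial>lborel)" .
  qed
qed

section \<open>A weighted Poincare inequality\<close>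

text \<open>Cauchy-Schwarz for the factorisation of \<open>\<bar>u x\<bar>\<close> into
  \<open>1 / sqrt (h x)\<close> and \<open>\<bar>u x\<bar> * sqrt (h x)\<close>.\<close>

lemma nn_integral_sq_le_Cauchy_Schwarz:
  fixes h u :: "real \<Rightarrow> real"
  assumes [measurable]: "h \<in> borel_measurable borel" "u \<in> borel_measurable borel" "S \<in> sets borel"
    and pos: "\<And>x. x \<in> S \<Longrightarrow> 0 < h x"
  shows "(\<integral>\<^sup>+x\<in>S. ennreal \<bar>u x\<bar> \<partial>lborel)\<^sup>2 \<le>
    (\<integral>\<^sup>+x\<in>S. ennreal (1 / h x) \<partial>lborel) * (\<integral>\<^sup>+x\<in>S. ennreal ((u x)\<^sup>2 * h x) \<partial>lborel)"
proof -
  let ?p = "\<lambda>x. ennreal (1 / sqrt (h x)) * indicator S x"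
  let ?q = "\<lambda>x. ennreal (\<bar>u x\<bar> * sqrt (h x)) * indicator S x"
  have "(\<integral>\<^sup>+x. ?p x * ?q x \<partial>lborel)\<^sup>2 \<le> (\<integral>\<^sup>+x. (?p x)\<^sup>2 \<partial>lborel) * (\<integral>\<^sup>+x. (?q x)\<^sup>2 \<partial>lborel)"
    by (rule Cauchy_Schwarz_nn_integral) auto
  also have "(\<integral>\<^sup>+x. ?p x * ?q x \<partial>lborel) = (\<integral>\<^sup>+x\<in>S. ennreal \<bar>u x\<bar> \<partial>lborel)"

  proof (rule nn_integral_cong)
    fix x
    show "?p x * ?q x = ennreal \<bar>u x\<bar> * indicator S x"
      using pos[of x] by (cases "x \<in> S") (auto simp: ennreal_mult[symmetric])
  qed
  also have "(\<integral>\<^sup>+x. (?p x)\<^sup>2 \<partial>lborel) = (\<integral>\<^sup>+x\<in>S. ennreal (1 / h x) \<partial>lborel)"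
    using pos by (intro nn_integral_cong) (auto simp: indicator_def ennreal_power power_divide less_imp_le)
  also have "(\<integral>\<^sup>+x. (?q x)\<^sup>2 \<partial>lborel) = (\<integral>\<^sup>+x\<in>S. ennreal ((u x)\<^sup>2 * h x) \<partial>lborel)"
    using pos by (intro nn_integral_cong) (auto simp: indicator_def ennreal_power power_mult_distrib less_imp_le)
  finally show ?thesis .
qed

text \<open>Cauchy-Schwarz bounds \<open>(f x - f c)\<^sup>2\<close> by a quantity \<open>VE\<close>
  that does not depend on \<open>x\<close>; integrating against \<open>h\<close> gives the remaining
  factor. The derivative of \<open>f\<close> enters only through \<open>u\<close> in the increment
  bound.\<close>

lemma weighted_Poincare_at_point:
  fixes f h u :: "real \<Rightarrow> real"
  assumes [measurable]: "h \<in> borel_measurable borel" "u \<in> borel_measurable borel"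
    and pos: "\<And>x. x \<in> {l..r} \<Longrightarrow> 0 < h x" and c: "c \<in> {l..r}"
    and incr: "\<And>a b. l \<le> a \<Longrightarrow> a \<le> b \<Longrightarrow> b \<le> r \<Longrightarrow>
      ennreal \<bar>f b - f a\<bar> \<le> (\<integral>\<^sup>+x\<in>{a..b}. ennreal \<bar>u x\<bar> \<partial>lborel)"
  shows "(\<integral>\<^sup>+x\<in>{l..r}. ennreal ((f x - f c)\<^sup>2 * h x) \<partial>lborel) \<le>
    (\<integral>\<^sup>+x\<in>{l..r}. ennreal (h x) \<partial>lborel) * (\<integral>\<^sup>+x\<in>{l..r}. ennreal (1 / h x) \<partial>lborel) *
    (\<integral>\<^sup>+x\<in>{l..r}. ennreal ((u x)\<^sup>2 * h x) \<partial>lborel)"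
proof -
  define VE where "VE = (\<integral>\<^sup>+x\<in>{l..r}. ennreal (1 / h x) \<partial>lborel) * (\<integral>\<^sup>+x\<in>{l..r}. ennreal ((u x)\<^sup>2 * h x) \<partial>lborel)"
  have pt: "ennreal ((f x - f c)\<^sup>2) \<le> VE" if x: "x \<in> {l..r}" for x
  proof -
    have "ennreal \<bar>f x - f c\<bar> \<le> (\<integral>\<^sup>+t\<in>{min x c..max x c}. ennreal \<bar>u t\<bar> \<partial>lborel)"
      using incr[of x c] incr[of c x] x c by (auto simp: min_def max_def abs_minus_commute)
    also have "\<dots> \<le> (\<integral>\<^sup>+t\<in>{l..r}. ennreal \<bar>u t\<bar> \<partial>lborel)"
      using x c by (intro nn_integral_mono mult_left_mono indicator_leI) auto
    finally have "(ennreal \<bar>f x - f c\<bar>)\<^sup>2 \<le> (\<integral>\<^sup>+t\<in>{l..r}. ennreal \<bar>u t\<bar> \<partial>lborel)\<^sup>2"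
      by (rule power_mono) auto
    also have "\<dots> \<le> VE"
      unfolding VE_def by (rule nn_integral_sq_le_Cauchy_Schwarz) (use pos in auto)
    finally show ?thesis by (simp add: ennreal_power)
  qed
  have "(\<integral>\<^sup>+x\<in>{l..r}. ennreal ((f x - f c)\<^sup>2 * h x) \<partial>lborel) \<le> (\<integral>\<^sup>+x. (ennreal (h x) * indicator {l..r} x) * VE \<partial>lborel)"
  proof (rule nn_integral_mono)
    fix x
    show "ennreal ((f x - f c)\<^sup>2 * h x) * indicator {l..r} x \<le> ennreal (h x) * indicator {l..r} x * VE"
    proof (cases "x \<in> {l..r}")
      case True
      have "ennreal ((f x - f c)\<^sup>2 * h x) = ennreal (h x) * ennreal ((f x - f c)\<^sup>2)"
        using pos[OF True] by (subst mult.commute) (rule ennreal_mult, auto)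
      also have "\<dots> \<le> ennreal (h x) * VE" by (rule mult_left_mono[OF pt[OF True]]) simp
      finally show ?thesis using True by simp
    qed auto
  qed
  also have "\<dots> = (\<integral>\<^sup>+x\<in>{l..r}. ennreal (h x) \<partial>lborel) * VE"
    by (rule nn_integral_multc) auto
  finally show ?thesis by (simp add: VE_def mult.assoc)
qed

text \<open>The growth condition says that \<open>h x * exp (- (\<kappa> * x))\<close> is
  nondecreasing. Comparison with the right endpoint bounds \<open>h\<close> above by an exponential,
  and comparison with the left endpoint does the same for \<open>1 / h\<close>. Both exponentials
  integrate explicitly, and the subtracted boundary terms are dropped.\<close>

lemma nn_integral_le_of_log_derivative:
  fixes h h' :: "real \<Rightarrow> real"
  assumes "l \<le> r" "0 < \<kappa>"
    and deriv: "\<And>x. x \<in> {l..r} \<Longrightarrow> (h has_real_derivative h' x) (at x)"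
    and pos: "\<And>x. x \<in> {l..r} \<Longrightarrow> 0 < h x"
    and growth: "\<And>x. x \<in> {l..r} \<Longrightarrow> \<kappa> * h x \<le> h' x"
  shows "(\<integral>\<^sup>+x\<in>{l..r}. ennreal (h x) \<partial>lborel) \<le> ennreal (h r / \<kappa>)"
    and "(\<integral>\<^sup>+x\<in>{l..r}. ennreal (1 / h x) \<partial>lborel) \<le> ennreal (1 / (\<kappa> * h l))"
proof -
  have "mono_on {l..r} (\<lambda>x. h x * exp (- (\<kappa> * x)))"
  proof (rule mono_onI)
    fix x y assume xy: "x \<in> {l..r}" "y \<in> {l..r}" "x \<le> y"
    have d: "((\<lambda>x. h x * exp (- (\<kappa> * x))) has_real_derivative (h' t - \<kappa> * h t) * exp (- (\<kappa> * t))) (at t)"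
      if "t \<in> {l..r}" for t
      using deriv[OF that] by (auto intro!: derivative_eq_intros simp: algebra_simps)
    show "h x * exp (- (\<kappa> * x)) \<le> h y * exp (- (\<kappa> * y))"
    proof (intro DERIV_nonneg_imp_nondecreasing[of x y "\<lambda>x. h x * exp (- (\<kappa> * x))"])
      fix t assume "x \<le> t" "t \<le> y"
      then have t: "t \<in> {l..r}" using xy by auto
      from this growth[OF this] show "\<exists>d. ((\<lambda>x. h x * exp (- (\<kappa> * x))) has_real_derivative d) (at t) \<and> 0 \<le> d"
        by (intro exI[of _ "(h' t - \<kappa> * h t) * exp (- (\<kappa> * t))"] conjI d mult_nonneg_nonneg) auto
    qed (use xy in auto)
  qed
  then have *: "h x * exp (- (\<kappa> * x)) \<le> h y * exp (- (\<kappa> * y))" if "l \<le> x" "x \<le> y" "y \<le> r" for x y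
    using that by (auto simp: mono_on_def)
  have "(\<integral>\<^sup>+x\<in>{l..r}. ennreal (h x) \<partial>lborel) \<le> (\<integral>\<^sup>+x. ennreal (h r * exp (\<kappa> * (x - r))) * indicator {l..r} x \<partial>lborel)"
  proof (intro nn_integral_mono)
    fix x
    have "h x \<le> h r * exp (\<kappa> * (x - r))" if "x \<in> {l..r}"
    proof -
      have "h x = h x * exp (- (\<kappa> * x)) * exp (\<kappa> * x)" by (simp add: mult.assoc exp_add[symmetric])
      also have "\<dots> \<le> h r * exp (- (\<kappa> * r)) * exp (\<kappa> * x)" using * that by (intro mult_right_mono) auto
      finally show ?thesis by (simp add: mult.assoc exp_add[symmetric] algebra_simps)
    qed
    then show "ennreal (h x) * indicator {l..r} x \<le> ennreal (h r * exp (\<kappa> * (x - r))) * indicator {l..r} x"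
      by (auto simp: indicator_def intro!: ennreal_leI)
  qed
  also have "\<dots> = ennreal (h r / \<kappa> * exp (\<kappa> * (r - r)) - h r / \<kappa> * exp (\<kappa> * (l - r)))"
    by (rule nn_integral_FTC_Icc)
      (use assms(1,2) pos[of r] in \<open>auto intro!: derivative_eq_intros simp: field_simps\<close>)
  also have "\<dots> \<le> ennreal (h r / \<kappa>)"
    using assms(1,2) pos[of r] by (intro ennreal_leI) auto
  finally show "(\<integral>\<^sup>+x\<in>{l..r}. ennreal (h x) \<partial>lborel) \<le> ennreal (h r / \<kappa>)" .
  have "(\<integral>\<^sup>+x\<in>{l..r}. ennreal (1 / h x) \<partial>lborel) \<le> (\<integral>\<^sup>+x. ennreal (exp (- \<kappa> * (x - l)) / h l) * indicator {l..r} x \<partial>lborel)"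
  proof (intro nn_integral_mono)
    fix x
    have "1 / h x \<le> exp (- \<kappa> * (x - l)) / h l" if x: "x \<in> {l..r}"
    proof -
      have "h l * exp (- (\<kappa> * l)) * exp (\<kappa> * x) \<le> h x * exp (- (\<kappa> * x)) * exp (\<kappa> * x)"
        using * that by (intro mult_right_mono) auto
      then have "h l * exp (\<kappa> * (x - l)) \<le> h x"
        by (simp add: mult.assoc exp_add[symmetric] algebra_simps)
      hence "1 / h x \<le> 1 / (h l * exp (\<kappa> * (x - l)))"
        using pos[of l] pos[OF x] x by (intro divide_left_mono) auto
      also have "\<dots> = exp (- \<kappa> * (x - l)) / h l"
        by (simp add: exp_minus inverse_eq_divide mult.commute)
      finally show ?thesis .
    qed
    then show "ennreal (1 / h x) * indicator {l..r} x \<le> ennreal (exp (- \<kappa> * (x - l)) / h l) * indicator {l..r} x"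
      by (auto simp: indicator_def intro!: ennreal_leI)
  qed
  also have "\<dots> = ennreal (- exp (- \<kappa> * (r - l)) / (\<kappa> * h l) - - exp (- \<kappa> * (l - l)) / (\<kappa> * h l))"
    by (rule nn_integral_FTC_Icc)
      (use assms(1,2) pos[of l] in \<open>auto intro!: derivative_eq_intros simp: field_simps\<close>)
  also have "\<dots> \<le> ennreal (1 / (\<kappa> * h l))"
    using assms(1,2) pos[of l] by (intro ennreal_leI) auto
  finally show "(\<integral>\<^sup>+x\<in>{l..r}. ennreal (1 / h x) \<partial>lborel) \<le> ennreal (1 / (\<kappa> * h l))" .
qed

section \<open>Passage from globally to locally Lipschitz functions\<close>

lemma locally_lipschitz_imp_lipschitz_on_Icc:
  assumes "locally_lipschitz f"
  obtains L where "L-lipschitz_on {a..b} f"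
proof -
  \<comment> \<open>The predicate \<open>local_lipschitz\<close> concerns families of functions; the
    singleton parameter set turns \<open>f\<close> into a constant family, to which the compactness
    argument applies.\<close>
  have "local_lipschitz {0::real} {a..b} (\<lambda>_. f)"
    unfolding local_lipschitz_def
  proof (intro ballI)
    fix x t :: real
    obtain u L where u: "u > 0" "L-lipschitz_on (ball x u) f"
      using assms unfolding locally_lipschitz_def by blast
    have "L-lipschitz_on (cball x (u/2) \<inter> {a..b}) f"
      by (rule lipschitz_on_subset[OF u(2)]) (use u in auto)
    then show "\<exists>u>0. \<exists>L. \<forall>t\<in>cball t u \<inter> {0}. L-lipschitz_on (cball x u \<inter> {a..b}) f"
      using u by (intro exI[of _ "u/2"]) auto
  qed
  then have "\<exists>L. \<forall>t\<in>{0::real}. L-lipschitz_on {a..b} f"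
    using local_lipschitz_compact_implies_lipschitz[of "{0::real}" "{a..b}" "\<lambda>_. f"]
    by (metis compact_Icc compact_insert compact_empty continuous_on_const)
  then show thesis using that by auto
qed

lemma locally_lipschitz_imp_continuous:
  assumes "locally_lipschitz f"
  shows "continuous_on UNIV f"
proof -
  have "isCont f x" for x
  proof -
    obtain u L where u: "u > 0" "L-lipschitz_on (ball x u) f"
      using assms unfolding locally_lipschitz_def by blast
    then show ?thesis
      using lipschitz_on_continuous_on[OF u(2)] by (simp add: continuous_on_eq_continuous_at)
  qed
  then show ?thesis by (simp add: continuous_on_eq_continuous_at)
qed

text \<open>Clamping the argument to \<open>{a..b}\<close> yields a globally Lipschitz function with
  the same values on the interval and the same derivative in its interior.\<close>

lemma locally_lipschitz_AE_deriv:
  assumes f: "locally_lipschitz f"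
  obtains u where "u \<in> borel_measurable borel"
    and "AE x in lborel. x \<in> {a..b} \<longrightarrow> deriv f x = u x"
    and "\<And>s t. a \<le> s \<Longrightarrow> s \<le> t \<Longrightarrow> t \<le> b \<Longrightarrow>
      ennreal \<bar>f t - f s\<bar> \<le> (\<integral>\<^sup>+x\<in>{s..t}. ennreal \<bar>u x\<bar> \<partial>lborel)"
proof (cases "a \<le> b")
  case True
  define F where "F x = f (max a (min x b))" for x
  obtain L where L: "L-lipschitz_on {a..b} f"
    using locally_lipschitz_imp_lipschitz_on_Icc[OF f] .
  have "L-lipschitz_on UNIV F"
  proof (rule lipschitz_onI)
    show "0 \<le> L" using L by (rule lipschitz_on_nonneg)
    fix x y
    have "dist (F x) (F y) \<le> L * dist (max a (min x b)) (max a (min y b))"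
      unfolding F_def using True by (intro lipschitz_onD[OF L]) auto
    also have "\<dots> \<le> L * dist x y"
      using True \<open>0 \<le> L\<close> by (intro mult_left_mono) (auto simp: dist_real_def)
    finally show "dist (F x) (F y) \<le> L * dist x y" .
  qed
  then obtain u where u: "u \<in> borel_measurable borel"
    "AE x in lborel. (F has_real_derivative u x) (at x)"
    "\<And>a b. a \<le> b \<Longrightarrow> ennreal \<bar>F b - F a\<bar> \<le> (\<integral>\<^sup>+x\<in>{a..b}. ennreal \<bar>u x\<bar> \<partial>lborel)"
    using lipschitz_AE_derivative by blast
  show thesis
  proof
    show "u \<in> borel_measurable borel" by fact
    \<comment> \<open>At the endpoints the clamped function can fail to have the derivative of
      \<open>f\<close>; two points form a null set.\<close>
    have "AE x in lborel. x \<noteq> a" "AE x in lborel. x \<noteq> b" by (rule AE_lborel_singleton)+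
    with u(2) show "AE x in lborel. x \<in> {a..b} \<longrightarrow> deriv f x = u x"
    proof eventually_elim
      case (elim x)
      show ?case
      proof
        assume "x \<in> {a..b}"
        then have "x \<in> {a<..<b}" using elim by auto
        then have "(f has_real_derivative u x) (at x)"
          by (intro has_field_derivative_transform_within_open[OF elim(1), of "{a<..<b}"]) (auto simp: F_def)
        then show "deriv f x = u x" by (rule DERIV_imp_deriv)
      qed
    qed
    show "ennreal \<bar>f t - f s\<bar> \<le> (\<integral>\<^sup>+x\<in>{s..t}. ennreal \<bar>u x\<bar> \<partial>lborel)"
      if "a \<le> s" "s \<le> t" "t \<le> b" for s t
      using u(3)[of s t] that by (simp add: F_def)
  qed
qed (use that[of "\<lambda>_. 0"] in auto)

section \<open>Lower bound for the spectral gap from the two sides of a point\<close>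

text \<open>A function of mean zero has its least weighted square deviation from the constant 0, so
  \<open>f\<close> may be replaced by \<open>f - f c\<close>. This difference vanishes at
  \<open>c\<close>, and the Poincare estimate applies on each side separately with the common
  constant \<open>H * V\<close>; the two energies add up to the total one.\<close>

lemma spectral_gap_ge_two_sided:
  fixes h :: "real \<Rightarrow> real"
  assumes [measurable]: "h \<in> borel_measurable borel"
    and c: "c \<in> {a..b}"
    and zero: "\<And>x. x \<notin> {a..b} \<Longrightarrow> h x = 0" and pos: "\<And>x. x \<in> {a..b} \<Longrightarrow> 0 < h x"
    and HV: "0 < H" "0 < V"
    and left: "(\<integral>\<^sup>+x\<in>{a..c}. ennreal (h x) \<partial>lborel) \<le> ennreal H"
      "(\<integral>\<^sup>+x\<in>{a..c}. ennreal (1 / h x) \<partial>lborel) \<le> ennreal V"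
    and right: "(\<integral>\<^sup>+x\<in>{c..b}. ennreal (h x) \<partial>lborel) \<le> ennreal H"
      "(\<integral>\<^sup>+x\<in>{c..b}. ennreal (1 / h x) \<partial>lborel) \<le> ennreal V"
  shows "ennreal (1 / (H * V)) \<le> spectral_gap h"
  unfolding spectral_gap_def
proof (rule INF_greatest, clarify)
  fix f assume adm: "admissible h f"
  have h0: "0 \<le> h x" for x using zero[of x] pos[of x] by (cases "x \<in> {a..b}") auto
  have [measurable]: "f \<in> borel_measurable borel"
    using adm by (intro borel_measurable_continuous_onI locally_lipschitz_imp_continuous) (simp add: admissible_def)
  obtain u where u[measurable]: "u \<in> borel_measurable borel"
    and ud: "AE x in lborel. x \<in> {a..b} \<longrightarrow> deriv f x = u x"
    and ui: "\<And>s t. a \<le> s \<Longrightarrow> s \<le> t \<Longrightarrow> t \<le> b \<Longrightarrow>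
      ennreal \<bar>f t - f s\<bar> \<le> (\<integral>\<^sup>+x\<in>{s..t}. ennreal \<bar>u x\<bar> \<partial>lborel)"
    using adm locally_lipschitz_AE_deriv[of f a b] unfolding admissible_def by blast
  define E where "E = (\<integral>\<^sup>+x. ennreal (\<bar>deriv f x\<bar>\<^sup>2 * h x) \<partial>lborel)"
  define Q where "Q = (\<integral>\<^sup>+x. ennreal ((f x)\<^sup>2 * h x) \<partial>lborel)"
  define m where "m = f c"
  let ?J = "\<lambda>S. \<integral>\<^sup>+x\<in>S. ennreal ((u x)\<^sup>2 * h x) \<partial>lborel"
  have Q: "0 < Q" "Q < \<infinity>" using adm by (auto simp: admissible_def Q_def)
  \<comment> \<open>The point \<open>c\<close> is counted twice, which is harmless in an upper
    bound.\<close>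
  have split: "g x \<le> g x * indicator {a..c} x + g x * indicator {c..b} x"
    if "x \<in> {a..b}" for g :: "real \<Rightarrow> ennreal" and x
    using that by (auto simp: indicator_def)
  have int_h: "integrable lborel h"
  proof (rule integrableI_nonneg)
    have "(\<integral>\<^sup>+x. ennreal (h x) \<partial>lborel) \<le> (\<integral>\<^sup>+x. ennreal (h x) * indicator {a..c} x + ennreal (h x) * indicator {c..b} x \<partial>lborel)"
      using split[of _ "\<lambda>x. ennreal (h x)"] zero by (intro nn_integral_mono) force
    also have "\<dots> \<le> ennreal H + ennreal H"
      using left(1) right(1) by (subst nn_integral_add) (auto intro: add_mono)
    also have "\<dots> < \<infinity>" by simp
    finally show "(\<integral>\<^sup>+x. ennreal (h x) \<partial>lborel) < \<infinity>" .
  qed (use h0 in auto)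
  have int_f2: "integrable lborel (\<lambda>x. (f x)\<^sup>2 * h x)"
    using Q(2) h0 by (intro integrableI_nonneg) (auto simp: Q_def)
  have int_f: "integrable lborel (\<lambda>x. f x * h x)" "(\<integral>x. f x * h x \<partial>lborel) = 0"
    using adm by (auto simp: admissible_def has_bochner_integral_iff)
  have eq: "(f x - m)\<^sup>2 * h x = (f x)\<^sup>2 * h x - 2 * m * (f x * h x) + m\<^sup>2 * h x" for x
    by (simp add: power2_diff algebra_simps)
  have int_fm: "integrable lborel (\<lambda>x. (f x - m)\<^sup>2 * h x)"
    unfolding eq by (intro Bochner_Integration.integrable_add Bochner_Integration.integrable_diff
        integrable_mult_right int_h int_f int_f2)
  have "Q = ennreal (\<integral>x. (f x)\<^sup>2 * h x \<partial>lborel)"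
    unfolding Q_def using h0 by (intro nn_integral_eq_integral int_f2) auto
  \<comment> \<open>The mean zero condition kills the cross term, and what is left over is
    \<open>m\<^sup>2\<close> times the integral of \<open>h\<close>, which is nonnegative.\<close>
  also have "\<dots> \<le> ennreal (\<integral>x. (f x - m)\<^sup>2 * h x \<partial>lborel)"
    unfolding eq using int_h int_f int_f2 h0
    by (intro ennreal_leI) (simp add: integral_nonneg_AE)
  also have "\<dots> = (\<integral>\<^sup>+x. ennreal ((f x - m)\<^sup>2 * h x) \<partial>lborel)"
    using h0 by (intro nn_integral_eq_integral[symmetric] int_fm) auto
  also have "\<dots> \<le> (\<integral>\<^sup>+x. ennreal ((f x - m)\<^sup>2 * h x) * indicator {a..c} x + ennreal ((f x - m)\<^sup>2 * h x) * indicator {c..b} x \<partial>lborel)"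
    using split[of _ "\<lambda>x. ennreal ((f x - m)\<^sup>2 * h x)"] zero by (intro nn_integral_mono) force
  also have "\<dots> = (\<integral>\<^sup>+x\<in>{a..c}. ennreal ((f x - m)\<^sup>2 * h x) \<partial>lborel) + (\<integral>\<^sup>+x\<in>{c..b}. ennreal ((f x - m)\<^sup>2 * h x) \<partial>lborel)"
    by (rule nn_integral_add) auto
  also have "\<dots> \<le> ennreal (H * V) * ?J {a..c} + ennreal (H * V) * ?J {c..b}"
  proof (rule add_mono)
    have "(\<integral>\<^sup>+x\<in>{a..c}. ennreal ((f x - m)\<^sup>2 * h x) \<partial>lborel) \<le>
       (\<integral>\<^sup>+x\<in>{a..c}. ennreal (h x) \<partial>lborel) * (\<integral>\<^sup>+x\<in>{a..c}. ennreal (1 / h x) \<partial>lborel) * ?J {a..c}"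
      unfolding m_def using c by (intro weighted_Poincare_at_point pos ui) auto
    also have "\<dots> \<le> ennreal H * ennreal V * ?J {a..c}"
      by (intro mult_mono left) auto
    finally show "(\<integral>\<^sup>+x\<in>{a..c}. ennreal ((f x - m)\<^sup>2 * h x) \<partial>lborel) \<le> ennreal (H * V) * ?J {a..c}"
      using HV by (simp add: ennreal_mult)
    have "(\<integral>\<^sup>+x\<in>{c..b}. ennreal ((f x - m)\<^sup>2 * h x) \<partial>lborel) \<le>
       (\<integral>\<^sup>+x\<in>{c..b}. ennreal (h x) \<partial>lborel) * (\<integral>\<^sup>+x\<in>{c..b}. ennreal (1 / h x) \<partial>lborel) * ?J {c..b}"
      unfolding m_def using c by (intro weighted_Poincare_at_point pos ui) auto
    also have "\<dots> \<le> ennreal H * ennreal V * ?J {c..b}"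
      by (intro mult_mono right) auto
    finally show "(\<integral>\<^sup>+x\<in>{c..b}. ennreal ((f x - m)\<^sup>2 * h x) \<partial>lborel) \<le> ennreal (H * V) * ?J {c..b}"
      using HV by (simp add: ennreal_mult)
  qed
  also have "\<dots> = ennreal (H * V) * (\<integral>\<^sup>+x. ennreal ((u x)\<^sup>2 * h x) * indicator {a..c} x + ennreal ((u x)\<^sup>2 * h x) * indicator {c..b} x \<partial>lborel)"
    by (subst nn_integral_add) (auto simp: distrib_left)
  also have "\<dots> \<le> ennreal (H * V) * E"
    unfolding E_def
  proof (intro mult_left_mono nn_integral_mono_AE)
    show "AE x in lborel. ennreal ((u x)\<^sup>2 * h x) * indicator {a..c} x + ennreal ((u x)\<^sup>2 * h x) * indicator {c..b} x
        \<le> ennreal (\<bar>deriv f x\<bar>\<^sup>2 * h x)"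
      \<comment> \<open>Away from \<open>c\<close> the two indicators never overlap, so the sum does
        not exceed the energy density.\<close>
      using ud AE_lborel_singleton[of c]
    proof eventually_elim
      case (elim x)
      then show ?case using c by (auto simp: indicator_def)
    qed
  qed simp
  finally have QE: "Q \<le> ennreal (H * V) * E" .
  \<comment> \<open>An infinite energy gives an infinite quotient because \<open>Q\<close> is
    finite.\<close>
  have "ennreal (1 / (H * V)) \<le> E / Q"
  proof (cases E)
    case (real e)
    obtain q where q: "Q = ennreal q" "q > 0" using Q by (cases Q) auto
    have "q \<le> H * V * e" using QE q real HV by (simp add: ennreal_mult[symmetric])
    then have "1 / (H * V) \<le> e / q" using HV q(2) by (simp add: field_simps)
    then show ?thesis using real q by (simp add: divide_ennreal ennreal_leI)
  next
    case top
    then show ?thesis using Q by (simp add: ennreal_top_divide)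
  qed
  then show "ennreal (1 / (H * V)) \<le> (\<integral>\<^sup>+x. ennreal (\<bar>deriv f x\<bar>\<^sup>2 * h x) \<partial>lborel) / (\<integral>\<^sup>+x. ennreal ((f x)\<^sup>2 * h x) \<partial>lborel)"
    by (simp add: E_def Q_def)
qed

section \<open>The density of the model space\<close>

text \<open>The difference of the two sides vanishes at 0 and has derivative
  \<open>x * sinh x\<close>. The inequality serves the growth rate
  \<open>(N - 1) / D\<close>.\<close>

lemma sinh_le_mult_cosh:
  fixes y :: real
  assumes "0 \<le> y"
  shows "sinh y \<le> y * cosh y"
proof -
  have "0 * cosh 0 - sinh 0 \<le> y * cosh y - sinh y"
  proof (rule DERIV_nonneg_imp_nondecreasing[OF assms])
    fix x :: real assume "0 \<le> x"
    moreover have "((\<lambda>y. y * cosh y - sinh y) has_real_derivative x * sinh x) (at x)"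
      by (auto intro!: derivative_eq_intros)
    ultimately show "\<exists>d. ((\<lambda>y. y * cosh y - sinh y) has_real_derivative d) (at x) \<and> 0 \<le> d"
      by (intro exI[of _ "x * sinh x"]) simp
  qed
  then show ?thesis by simp
qed

lemma s_fun_pos: "\<kappa> < 0 \<Longrightarrow> 0 < x \<Longrightarrow> 0 < s_fun \<kappa> x"
  by (simp add: s_fun_def divide_less_0_iff)

lemma s_fun_mono: "\<kappa> < 0 \<Longrightarrow> x \<le> y \<Longrightarrow> s_fun \<kappa> x \<le> s_fun \<kappa> y"
  by (simp add: s_fun_def divide_le_0_iff mult_left_mono)

text \<open>The two-sided bound at \<open>c = D/2\<close> with \<open>H = h D * \<tau>\<close> and
  \<open>V = \<tau> / h (D/2)\<close>: the quotient \<open>h (D/2) / h D\<close> is exactly the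
  power of \<open>sigma_half\<close>. The density is symmetric about \<open>D/2\<close>, so
  estimates on the right half suffice.\<close>

lemma spectral_gap_h_dens_ge:
  assumes "K < 0" "1 < N" "0 < D" and \<tau>: "0 < \<tau>"
    and right: "(\<integral>\<^sup>+x\<in>{D/2..D}. ennreal (h_dens K N D x) \<partial>lborel) \<le> ennreal (h_dens K N D D * \<tau>)"
      "(\<integral>\<^sup>+x\<in>{D/2..D}. ennreal (1 / h_dens K N D x) \<partial>lborel) \<le> ennreal (\<tau> / h_dens K N D (D/2))"
  shows "ennreal (sigma_half K (N - 1) D powr (N - 1) / \<tau>\<^sup>2) \<le> spectral_gap (h_dens K N D)"
proof -
  define h where "h = h_dens K N D"
  have s_pos: "0 < s_fun (K / (N - 1)) x" if "0 < x" for x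
    using assms that by (intro s_fun_pos divide_neg_pos) auto
  have meas[measurable]: "h \<in> borel_measurable borel"
    unfolding h_def h_dens_def[abs_def] s_fun_def sinh_def by measurable
  have zero: "h x = 0" if "x \<notin> {0..D}" for x
    using that assms by (auto simp: h_def h_dens_def)
  have pos: "0 < h x" if "x \<in> {0..D}" for x
    using that assms s_pos[of x] s_pos[of "D - x"] by (auto simp: h_def h_dens_def)
  have sym: "h (D - x) = h x" for x
    using assms by (auto simp: h_def h_dens_def)
  have refl: "(\<integral>\<^sup>+x\<in>{0..D/2}. ennreal (g x) \<partial>lborel) = (\<integral>\<^sup>+x\<in>{D/2..D}. ennreal (g x) \<partial>lborel)"
    if [measurable]: "g \<in> borel_measurable borel" and g: "\<And>x. g (D - x) = g x" for g
  proof -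
    \<comment> \<open>The affine substitution here is the reflection sending \<open>x\<close> to
      \<open>D - x\<close>.\<close>
    have "(\<integral>\<^sup>+x\<in>{0..D/2}. ennreal (g x) \<partial>lborel) = ennreal \<bar>-1\<bar> *
        (\<integral>\<^sup>+x. ennreal (g (D + - 1 * x)) * indicator {0..D/2} (D + - 1 * x) \<partial>lborel)"
      by (rule nn_integral_real_affine) auto
    also have "\<dots> = (\<integral>\<^sup>+x\<in>{D/2..D}. ennreal (g x) \<partial>lborel)"
      by (auto intro!: nn_integral_cong simp: g indicator_def field_simps)
    finally show ?thesis .
  qed
  have "ennreal (1 / ((h D * \<tau>) * (\<tau> / h (D/2)))) \<le> spectral_gap h"
  proof (rule spectral_gap_ge_two_sided)
    show "D / 2 \<in> {0..D}" using assms by auto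
    show "0 < h D * \<tau>" "0 < \<tau> / h (D/2)" using \<tau> pos assms by auto
    show "(\<integral>\<^sup>+x\<in>{0..D/2}. ennreal (h x) \<partial>lborel) \<le> ennreal (h D * \<tau>)"
      using right(1) by (subst refl) (auto simp: sym h_def[symmetric])
    show "(\<integral>\<^sup>+x\<in>{0..D/2}. ennreal (1 / h x) \<partial>lborel) \<le> ennreal (\<tau> / h (D/2))"
      using right(2) by (subst refl) (auto simp: sym h_def[symmetric])
  qed (use meas zero pos right in \<open>auto simp: h_def\<close>)
  also have "1 / ((h D * \<tau>) * (\<tau> / h (D/2))) = sigma_half K (N - 1) D powr (N - 1) / \<tau>\<^sup>2"
    using assms s_pos[of D] s_pos[of "D/2"]
    by (simp add: h_def h_dens_def sigma_half_def powr_divide power2_eq_square)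
  finally show ?thesis by (simp add: h_def)
qed

section \<open>Admissible values of \<open>\<tau>\<close> for the model density\<close>

lemma h_dens_eq_right:
  assumes "0 < D" "x \<in> {D/2..D}"
  shows "h_dens K N D x = s_fun (K / (N - 1)) x powr (N - 1)"
  using assms by (auto simp: h_dens_def)

text \<open>Here \<open>\<tau> = 1 / \<kappa>\<close>. Since \<open>s_fun\<close> has derivative
  \<open>cosh\<close>, the growth hypothesis is the inequality
  \<open>\<kappa> * h x \<le> h' x\<close> on the right half, divided by the positive factor
  \<open>s x powr (N - 1 - 1)\<close>.\<close>

lemma spectral_gap_h_dens_ge_growth:
  assumes KND: "K < 0" "1 < N" "0 < D" and \<kappa>: "0 < \<kappa>"
    and growth: "\<And>x. x \<in> {D/2..D} \<Longrightarrow> \<kappa> * s_fun (K / (N - 1)) x \<le> (N - 1) * cosh (sqrt (- K / (N - 1)) * x)"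
  shows "ennreal (sigma_half K (N - 1) D powr (N - 1) * \<kappa>\<^sup>2) \<le> spectral_gap (h_dens K N D)"
proof -
  define a where "a = sqrt (- K / (N - 1))"
  define s where "s = s_fun (K / (N - 1))"
  have a: "0 < a" using KND by (simp add: a_def divide_less_0_iff)
  have s: "s x = sinh (a * x) / a" for x
    by (simp add: s_def s_fun_def a_def real_sqrt_divide real_sqrt_minus)
  have pos: "0 < s x" if "0 < x" for x using that a by (simp add: s)
  have deriv: "((\<lambda>x. s x powr (N - 1)) has_real_derivative (N - 1) * s x powr (N - 1 - 1) * cosh (a * x)) (at x)"
    if "0 < x" for x
  proof -
    have "(s has_real_derivative cosh (a * x)) (at x)"
      unfolding s[abs_def] using a by (auto intro!: derivative_eq_intros)
    from DERIV_fun_powr[OF this pos[OF that], of "N - 1"] show ?thesis by simp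
  qed
  have gr: "\<kappa> * (s x powr (N - 1)) \<le> (N - 1) * s x powr (N - 1 - 1) * cosh (a * x)" if x: "x \<in> {D/2..D}" for x
  proof -
    have "0 < x" using x KND by auto
    then have "s x powr (N - 1) = s x * s x powr (N - 1 - 1)"
      using pos[of x] powr_mult_base[of "s x" "N - 1 - 1"] by simp
    then show ?thesis
      using mult_right_mono[OF growth[OF x], of "s x powr (N - 1 - 1)"] by (simp add: s_def a_def ac_simps)
  qed
  have eq: "h_dens K N D x = s x powr (N - 1)" if "x \<in> {D/2..D}" for x
    using h_dens_eq_right KND that by (simp add: s_def)
  have "ennreal (sigma_half K (N - 1) D powr (N - 1) / (1 / \<kappa>)\<^sup>2) \<le> spectral_gap (h_dens K N D)"
  proof (rule spectral_gap_h_dens_ge[OF KND])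
    have *: "(\<integral>\<^sup>+x\<in>{D/2..D}. ennreal (s x powr (N - 1)) \<partial>lborel) \<le> ennreal (s D powr (N - 1) / \<kappa>) \<and>
      (\<integral>\<^sup>+x\<in>{D/2..D}. ennreal (1 / (s x powr (N - 1))) \<partial>lborel) \<le> ennreal (1 / (\<kappa> * s (D/2) powr (N - 1)))"
      by (intro conjI nn_integral_le_of_log_derivative[OF _ \<kappa> deriv _ gr])
        (use KND in \<open>auto simp: less_imp_neq[OF pos, symmetric]\<close>)
    have "(\<integral>\<^sup>+x\<in>{D/2..D}. ennreal (h_dens K N D x) \<partial>lborel) = (\<integral>\<^sup>+x\<in>{D/2..D}. ennreal (s x powr (N - 1)) \<partial>lborel)"
      using eq by (intro nn_integral_cong) (auto simp: indicator_def)
    with * show "(\<integral>\<^sup>+x\<in>{D/2..D}. ennreal (h_dens K N D x) \<partial>lborel) \<le> ennreal (h_dens K N D D * (1 / \<kappa>))"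
      using eq[of D] KND by simp
    have "(\<integral>\<^sup>+x\<in>{D/2..D}. ennreal (1 / h_dens K N D x) \<partial>lborel) = (\<integral>\<^sup>+x\<in>{D/2..D}. ennreal (1 / (s x powr (N - 1))) \<partial>lborel)"
      using eq by (intro nn_integral_cong) (auto simp: indicator_def)
    with * show "(\<integral>\<^sup>+x\<in>{D/2..D}. ennreal (1 / h_dens K N D x) \<partial>lborel) \<le> ennreal (1 / \<kappa> / h_dens K N D (D/2))"
      using eq[of "D/2"] KND by simp
  qed (use \<kappa> in simp)
  then show ?thesis by (simp add: power_divide)
qed

text \<open>Here \<open>\<tau> = D/2\<close>: on the right half the density increases from its value
  at \<open>D/2\<close> to its value at \<open>D\<close>, so each integral is at most the length
  times the maximum of the integrand.\<close>

lemma spectral_gap_h_dens_ge_length: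
  assumes KND: "K < 0" "1 < N" "0 < D"
  shows "ennreal (sigma_half K (N - 1) D powr (N - 1) * (4 / D\<^sup>2)) \<le> spectral_gap (h_dens K N D)"
proof -
  define s where "s = s_fun (K / (N - 1))"
  have s_mono: "s x \<le> s y" if "x \<le> y" for x y
    using KND that unfolding s_def by (intro s_fun_mono divide_neg_pos) auto
  have s_pos: "0 < s x" if "0 < x" for x
    using KND that unfolding s_def by (intro s_fun_pos divide_neg_pos) auto
  have eq: "h_dens K N D x = s x powr (N - 1)" if "x \<in> {D/2..D}" for x
    using h_dens_eq_right KND that by (simp add: s_def)
  have const: "(\<integral>\<^sup>+x\<in>{D/2..D}. ennreal (g x) \<partial>lborel) \<le> ennreal (M * (D/2))"
    if "0 \<le> M" and g: "\<And>x. x \<in> {D/2..D} \<Longrightarrow> g x \<le> M" for g M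
  proof -
    have "(\<integral>\<^sup>+x\<in>{D/2..D}. ennreal (g x) \<partial>lborel) \<le> (\<integral>\<^sup>+x\<in>{D/2..D}. ennreal M \<partial>lborel)"
      using g by (intro nn_integral_mono) (auto simp: indicator_def ennreal_leI)
    also have "\<dots> = ennreal (M * (D/2))"
      using KND that(1) by (subst nn_integral_cmult_indicator) (auto simp: ennreal_mult[symmetric])
    finally show ?thesis .
  qed
  have "ennreal (sigma_half K (N - 1) D powr (N - 1) / (D/2)\<^sup>2) \<le> spectral_gap (h_dens K N D)"
  proof (rule spectral_gap_h_dens_ge[OF KND])
    have bd: "s (D/2) powr (N - 1) \<le> s x powr (N - 1)" "s x powr (N - 1) \<le> s D powr (N - 1)"
      if "x \<in> {D/2..D}" for x
      using that KND s_pos[of "D/2"] s_pos[of x] s_mono by (auto intro!: powr_mono2)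
    show "(\<integral>\<^sup>+x\<in>{D/2..D}. ennreal (h_dens K N D x) \<partial>lborel) \<le> ennreal (h_dens K N D D * (D/2))"
      using KND eq bd by (intro const) auto
    have "(\<integral>\<^sup>+x\<in>{D/2..D}. ennreal (1 / h_dens K N D x) \<partial>lborel) \<le> ennreal (1 / h_dens K N D (D/2) * (D/2))"
    proof (rule const)
      fix x assume x: "x \<in> {D/2..D}"
      then show "1 / h_dens K N D x \<le> 1 / h_dens K N D (D/2)"
        using KND eq[OF x] eq[of "D/2"] bd[OF x] s_pos[of "D/2"] s_pos[of x] by (auto intro!: divide_left_mono)
    qed (use KND eq[of "D/2"] in auto)
    then show "(\<integral>\<^sup>+x\<in>{D/2..D}. ennreal (1 / h_dens K N D x) \<partial>lborel) \<le> ennreal (D / 2 / h_dens K N D (D/2))"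
      by (simp add: mult.commute)
  qed (use KND in simp)
  then show ?thesis by (simp add: power_divide mult.commute)
qed

theorem lemma5p3:
  fixes K N D :: real
  assumes "K < 0" and "1 < N" and "0 < D"
  shows "spectral_gap (h_dens K N D)
    \<ge> ennreal (1 / 4 * max (\<bar>K\<bar> * (N - 1)) (N\<^sup>2 / D\<^sup>2) * sigma_half K (N - 1) D powr (N - 1))"
proof -
  define a where "a = sqrt (- K / (N - 1))"
  define \<sigma> where "\<sigma> = sigma_half K (N - 1) D powr (N - 1)"
  have a: "0 < a" "a\<^sup>2 = - K / (N - 1)" using assms by (simp_all add: a_def divide_less_0_iff divide_le_0_iff)
  have s: "s_fun (K / (N - 1)) x = sinh (a * x) / a" for x
    by (simp add: s_fun_def a_def real_sqrt_divide real_sqrt_minus)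
  \<comment> \<open>The rate \<open>\<kappa> = (N - 1) * a\<close> comes from
    \<open>sinh \<le> cosh\<close>; its square is \<open>\<bar>K\<bar> * (N - 1)\<close>.\<close>
  have curvature: "ennreal (\<sigma> * ((N - 1) * a)\<^sup>2) \<le> spectral_gap (h_dens K N D)"
    unfolding \<sigma>_def
  proof (rule spectral_gap_h_dens_ge_growth[OF assms])
    show "(N - 1) * a * s_fun (K / (N - 1)) x \<le> (N - 1) * cosh (sqrt (- K / (N - 1)) * x)" for x
      using a assms sinh_le_cosh_real[of "a * x"] unfolding s a_def[symmetric] by simp
  qed (use a assms in simp)
  \<comment> \<open>The rate \<open>\<kappa> = (N - 1) / D\<close> comes from
    \<open>sinh (a * x) \<le> a * x * cosh (a * x)\<close> together with
    \<open>x \<le> D\<close>.\<close>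
  have dimension: "ennreal (\<sigma> * ((N - 1) / D)\<^sup>2) \<le> spectral_gap (h_dens K N D)"
    unfolding \<sigma>_def
  proof (rule spectral_gap_h_dens_ge_growth[OF assms])
    fix x assume x: "x \<in> {D/2..D}"
    then have "0 \<le> x" "x \<le> D" using assms by auto
    have "sinh (a * x) \<le> a * x * cosh (a * x)"
      using a \<open>0 \<le> x\<close> by (intro sinh_le_mult_cosh) simp
    also have "\<dots> \<le> a * D * cosh (a * x)"
      using a \<open>x \<le> D\<close> by (intro mult_right_mono mult_left_mono) auto
    finally have "sinh (a * x) / a / D \<le> cosh (a * x)"
      using a assms by (simp add: field_simps)
    then have "(N - 1) * (sinh (a * x) / a / D) \<le> (N - 1) * cosh (a * x)"
      using assms by (intro mult_left_mono) auto
    then show "(N - 1) / D * s_fun (K / (N - 1)) x \<le> (N - 1) * cosh (sqrt (- K / (N - 1)) * x)"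
      unfolding s a_def[symmetric] by (simp add: ac_simps)
  qed (use assms in simp)
  have length: "ennreal (\<sigma> * (4 / D\<^sup>2)) \<le> spectral_gap (h_dens K N D)"
    unfolding \<sigma>_def by (rule spectral_gap_h_dens_ge_length[OF assms])
  have sigma: "0 \<le> \<sigma>" by (simp add: \<sigma>_def)
  \<comment> \<open>The factor 1/4 of the theorem becomes a slack of 4 when a constant is compared
    with the bounds above.\<close>
  have weaken: "ennreal (1 / 4 * M * \<sigma>) \<le> spectral_gap (h_dens K N D)"
    if "ennreal (\<sigma> * c) \<le> spectral_gap (h_dens K N D)" "M \<le> 4 * c" for M c
  proof -
    have "1 / 4 * M * \<sigma> \<le> \<sigma> * c"
      using mult_left_mono[OF that(2) sigma] by (simp add: algebra_simps)
    then show ?thesis using that(1) by (meson ennreal_leI order_trans)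
  qed
  have "ennreal (1 / 4 * (\<bar>K\<bar> * (N - 1)) * \<sigma>) \<le> spectral_gap (h_dens K N D)"
  proof (rule weaken[OF curvature])
    have "((N - 1) * a)\<^sup>2 = \<bar>K\<bar> * (N - 1)"
      unfolding power_mult_distrib a(2) using assms by (simp add: power2_eq_square)
    then show "\<bar>K\<bar> * (N - 1) \<le> 4 * ((N - 1) * a)\<^sup>2" using assms by simp
  qed
  moreover have "ennreal (1 / 4 * (N\<^sup>2 / D\<^sup>2) * \<sigma>) \<le> spectral_gap (h_dens K N D)"
  \<comment> \<open>For \<open>2 \<le> N\<close> one has \<open>N \<le> 2 * (N - 1)\<close>, so the
    rate \<open>(N - 1) / D\<close> is large enough. As \<open>N\<close> tends to 1 that rate
    degenerates, and the length bound takes over: it needs only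
    \<open>N\<^sup>2 \<le> 16\<close>.\<close>
  proof (cases "2 \<le> N")
    case True
    then have "N\<^sup>2 \<le> (2 * (N - 1))\<^sup>2" by (intro power_mono) auto
    then have "N\<^sup>2 / D\<^sup>2 \<le> (2 * (N - 1))\<^sup>2 / D\<^sup>2" by (intro divide_right_mono) auto
    then have "N\<^sup>2 / D\<^sup>2 \<le> 4 * ((N - 1) / D)\<^sup>2"
      unfolding power_divide power_mult_distrib by simp
    then show ?thesis by (rule weaken[OF dimension])
  next
    case False
    then have "N\<^sup>2 \<le> 2\<^sup>2" using assms by (intro power_mono) auto
    then have "N\<^sup>2 / D\<^sup>2 \<le> 4 * (4 / D\<^sup>2)"
      using divide_right_mono[of "N\<^sup>2" 16 "D\<^sup>2"] by simp
    then show ?thesis by (rule weaken[OF length])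
  qed
  ultimately show ?thesis unfolding max_def \<sigma>_def[symmetric] by presburger
qed

end
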